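(* Let $X\subset\mathbb R^2$ be a smooth plane dendroid with initial point $p$. Then every endpoint $e\in E(X)\setminus\{p\}$ is accessible from $\mathbb R^2\setminus X$, i.e. there is an arc $\gamma\subset\mathbb R^2$ such that $\gamma\setminus(\mathbb R^2\setminus X)=\{e\}$.
   Context: A continuum is a compact connected metric space. It is hereditarily unicoherent if every two of its subcontinua have connected intersection. A dendroid is a hereditarily unicoherent, arcwise connected continuum (hence uniquely arcwise connected); for $x,y$ in a dendroid $X$, $\alpha(x,y)$ denotes the unique arc in $X$ with endpoints $x$ and $y$ (with $\alpha(x,x)=\{x\}$). A plane dendroid is a dendroid $X\subset\mathbb R^2$. A dendroid $X$ is smooth at $p\in X$ (and $p$ is called an initial point of $X$) if whenever $x_n\to x$ in $X$, $\alpha(x_n,p)\to\alpha(x,p)$ in the Hausdorff distance; $X$ is smooth if it is smooth at some point. A point $e\in X$ is an endpoint if $e$ is an endpoint of every arc in $X$ that contains it; $E(X)$ is the set of all endpoints of $X$. If $U\subset\mathbb R^2$ is open, a point $z\in\mathbb R^2\setminus U$ is accessible from $U$ if there is an arc $\gamma\subset\mathbb R^2$ with $\gamma\setminus U=\{z\}$. *)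

theory Defs
  imports "HOL-Analysis.Analysis"
begin

definition continuum :: "'a::metric_space set \<Rightarrow> bool" where
  "continuum X \<longleftrightarrow> compact X \<and> connected X"

definition hereditarily_unicoherent :: "'a::metric_space set \<Rightarrow> bool" where
  "hereditarily_unicoherent X \<longleftrightarrow>
     (\<forall>A B. A \<subseteq> X \<and> B \<subseteq> X \<and> continuum A \<and> continuum B \<longrightarrow> connected (A \<inter> B))"

definition is_arc_between :: "'a::metric_space set \<Rightarrow> 'a \<Rightarrow> 'a \<Rightarrow> bool" where
  "is_arc_between A x y \<longleftrightarrow>
     (\<exists>g. arc g \<and> path_image g = A \<and> pathstart g = x \<and> pathfinish g = y)"

definition arcwise_connected :: "'a::metric_space set \<Rightarrow> bool" where
  "arcwise_connected X \<longleftrightarrow>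
     (\<forall>x\<in>X. \<forall>y\<in>X. x \<noteq> y \<longrightarrow> (\<exists>A. A \<subseteq> X \<and> is_arc_between A x y))"

definition dendroid :: "'a::metric_space set \<Rightarrow> bool" where
  "dendroid X \<longleftrightarrow> continuum X \<and> hereditarily_unicoherent X \<and> arcwise_connected X"

text \<open>The value is meaningful for points of a dendroid: see \<open>dendroid_unique_arc\<close> below.\<close>

definition arc_in :: "'a::metric_space set \<Rightarrow> 'a \<Rightarrow> 'a \<Rightarrow> 'a set" where
  "arc_in X x y = (if x = y then {x} else (THE A. A \<subseteq> X \<and> is_arc_between A x y))"

text \<open>Intended for nonempty compact sets, where both suprema are over bounded nonempty sets.\<close>

definition hausdorff_dist :: "'a::metric_space set \<Rightarrow> 'a set \<Rightarrow> real" where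
  "hausdorff_dist A B = max (SUP a\<in>A. infdist a B) (SUP b\<in>B. infdist b A)"

definition smooth_at :: "'a::metric_space set \<Rightarrow> 'a \<Rightarrow> bool" where
  "smooth_at X p \<longleftrightarrow> p \<in> X \<and>
     (\<forall>s x. (\<forall>n::nat. s n \<in> X) \<and> x \<in> X \<and> s \<longlonglongrightarrow> x \<longrightarrow>
        (\<lambda>n. hausdorff_dist (arc_in X (s n) p) (arc_in X x p)) \<longlonglongrightarrow> 0)"

definition endpoints :: "'a::metric_space set \<Rightarrow> 'a set" where
  "endpoints X = {e \<in> X. \<forall>A x y. A \<subseteq> X \<and> is_arc_between A x y \<and> e \<in> A \<longrightarrow> e = x \<or> e = y}"

definition accessible_from :: "'a::metric_space \<Rightarrow> 'a set \<Rightarrow> bool" where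
  "accessible_from z U \<longleftrightarrow> (\<exists>\<gamma>. arc \<gamma> \<and> path_image \<gamma> - U = {z})"

lemma arc_connected_subset_full:
  fixes g :: "real \<Rightarrow> 'a::metric_space"
  assumes "arc g" "connected S" "S \<subseteq> path_image g" "pathstart g \<in> S" "pathfinish g \<in> S"
  shows "S = path_image g"
proof -
  obtain h where h: "homeomorphism {0..1} (path_image g) g h"
    using homeomorphism_arc[OF assms(1)] by blast
  have "continuous_on S h"
    using homeomorphism_cont2[OF h] assms(3) continuous_on_subset by blast
  then have c: "connected (h ` S)"
    using assms(2) by (rule connected_continuous_image)
  have "h (g 0) = 0" "h (g 1) = 1"
    using homeomorphism_apply1[OF h] by auto
  then have "0 \<in> h ` S" "1 \<in> h ` S"
    using imageI[OF assms(4), of h] imageI[OF assms(5), of h]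
    by (simp_all add: pathstart_def pathfinish_def)
  then have sub: "{0..1} \<subseteq> h ` S"
    using connected_contains_Icc[OF c] by blast
  have "g ` {0..1} \<subseteq> S"
  proof
    fix z assume "z \<in> g ` {0..1}"
    then obtain t where t: "t \<in> {0..1}" "z = g t" by (rule imageE)
    from t(1) sub have "t \<in> h ` S" by (rule subsetD[rotated])
    then obtain w where w: "t = h w" "w \<in> S" by (rule imageE)
    have "g (h w) = w"
      using w(2) assms(3) homeomorphism_apply2[OF h] by blast
    then show "z \<in> S" using t w by simp
  qed
  with assms(3) show ?thesis by (auto simp: path_image_def)
qed

lemma dendroid_unique_arc:
  assumes "dendroid X" "x \<in> X" "y \<in> X" "x \<noteq> y"
  shows "\<exists>!A. A \<subseteq> X \<and> is_arc_between A x y"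
proof (rule ex_ex1I)
  show "\<exists>A. A \<subseteq> X \<and> is_arc_between A x y"
    using assms by (auto simp: dendroid_def arcwise_connected_def)
next
  fix A B
  assume AB: "A \<subseteq> X \<and> is_arc_between A x y" "B \<subseteq> X \<and> is_arc_between B x y"
  then obtain g h where g: "arc g" "path_image g = A" "pathstart g = x" "pathfinish g = y"
    and h: "arc h" "path_image h = B" "pathstart h = x" "pathfinish h = y"
    by (auto simp: is_arc_between_def)
  have "continuum A" "continuum B"
    unfolding continuum_def g(2)[symmetric] h(2)[symmetric]
    using arc_imp_path[OF g(1)] arc_imp_path[OF h(1)]
    by (simp_all add: compact_path_image connected_path_image)
  then have c: "connected (A \<inter> B)"
    using assms(1) AB by (auto simp: dendroid_def hereditarily_unicoherent_def)
  have "x \<in> A \<inter> B" "y \<in> A \<inter> B"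
    using pathstart_in_path_image[of g] pathstart_in_path_image[of h]
      pathfinish_in_path_image[of g] pathfinish_in_path_image[of h] g h by simp_all
  then have "A \<inter> B = A" "A \<inter> B = B"
    using arc_connected_subset_full[OF g(1) c] arc_connected_subset_full[OF h(1) c] g h by auto
  then show "A = B" by simp
qed

end

theory Submission
  imports Defs
begin

text \<open>
  The relation ``\<open>y\<close> lies on the arc from \<open>x\<close> to \<open>p\<close>'' is closed by smoothness, and \<open>e\<close> is a maximal
  element of it. Hence arcs from \<open>p\<close> to points far from \<open>e\<close> stay away from \<open>e\<close>. As moreover \<open>X\<close>
  does not separate the plane, Janiszewski's theorem shows that two points of the complement close
  to \<open>e\<close> can be joined in the complement near \<open>e\<close>. Since \<open>X\<close> has no interior at \<open>e\<close>, an
  infinite concatenation of such short paths converges to \<open>e\<close>.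
\<close>

section \<open>Arcs in dendroids\<close>

lemma arc_in_arc:
  assumes "dendroid X" "x \<in> X" "y \<in> X" "x \<noteq> y"
  shows "arc_in X x y \<subseteq> X \<and> is_arc_between (arc_in X x y) x y"
  using theI'[OF dendroid_unique_arc[OF assms]] assms(4) by (simp add: arc_in_def)

lemma is_arc_between_properties:
  fixes A :: "'a::real_normed_vector set"
  assumes "is_arc_between A x y"
  shows "x \<in> A" "y \<in> A" "compact A" "connected A" "contractible A"
proof -
  obtain g where g: "arc g" "path_image g = A" "pathstart g = x" "pathfinish g = y"
    using assms by (auto simp: is_arc_between_def)
  show "x \<in> A" "y \<in> A" using g by force+
  show "compact A" "connected A"
    using g compact_path_image connected_path_image arc_imp_path by blast+
  obtain h where "homeomorphism {0..1} (path_image g) g h"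
    using homeomorphism_arc[OF g(1)] .
  then have "{0..1::real} homeomorphic A"
    unfolding homeomorphic_def g(2) by blast
  moreover have "contractible {0..1::real}"
    by (simp add: convex_imp_contractible)
  ultimately show "contractible A"
    using homeomorphic_contractible_eq by blast
qed

lemma arc_in_properties:
  fixes X :: "'a::real_normed_vector set"
  assumes "dendroid X" "x \<in> X" "y \<in> X"
  shows "arc_in X x y \<subseteq> X" "x \<in> arc_in X x y" "y \<in> arc_in X x y"
    "compact (arc_in X x y)" "connected (arc_in X x y)" "contractible (arc_in X x y)"
  using arc_in_arc[OF assms] is_arc_between_properties[of "arc_in X x y" x y] assms(2)
  by (cases "x = y"; simp add: arc_in_def)+

text \<open>As \<open>e\<close> is an extremity of every arc of \<open>X\<close> through it and
  differs from \<open>p\<close>, only \<open>x\<close> is left. This is the maximality of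
  \<open>e\<close> in the order given by arcs to \<open>p\<close>.\<close>

lemma endpoint_in_arc_in:
  assumes "dendroid X" "x \<in> X" "p \<in> X" "e \<in> endpoints X - {p}" "e \<in> arc_in X x p"
  shows "x = e"
proof (cases "x = p")
  case True
  then show ?thesis using assms by (simp add: arc_in_def)
next
  case False
  then show ?thesis
    using arc_in_arc[OF assms(1-3)] assms(4,5) by (auto simp: endpoints_def)
qed

section \<open>Smoothness\<close>

lemma infdist_le_hausdorff_dist:
  assumes "compact A" "a \<in> A"
  shows "infdist a B \<le> hausdorff_dist A B"
proof -
  have "compact ((\<lambda>a. infdist a B) ` A)"
    by (intro compact_continuous_image continuous_intros assms)
  then have "bdd_above ((\<lambda>a. infdist a B) ` A)"
    by (simp add: bounded_imp_bdd_above compact_imp_bounded)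
  then have "infdist a B \<le> (SUP a\<in>A. infdist a B)"
    using assms(2) by (rule cSUP_upper2) simp
  then show ?thesis by (simp add: hausdorff_dist_def)
qed

text \<open>Upper semicontinuity of arcs to \<open>p\<close>: by compactness \<open>V\<close>
  contains a uniform neighbourhood of the limit arc, and arcs at small Hausdorff distance lie in
  it.\<close>

lemma smooth_at_arcs_eventually_subset:
  fixes X :: "'a::real_normed_vector set"
  assumes X: "dendroid X" "smooth_at X p"
    and s: "\<And>n. s n \<in> X" "x \<in> X" "s \<longlonglongrightarrow> x"
    and V: "open V" "arc_in X x p \<subseteq> V"
  shows "\<forall>\<^sub>F n in sequentially. arc_in X (s n) p \<subseteq> V"
proof -
  have p: "p \<in> X" using X(2) by (simp add: smooth_at_def)
  note K = arc_in_properties[OF X(1) s(2) p]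
  obtain r where r: "r > 0" "(\<Union>a\<in>arc_in X x p. ball a r) \<subseteq> V"
    using compact_subset_open_imp_ball_epsilon_subset[OF K(4) V] by blast
  have "(\<lambda>n. hausdorff_dist (arc_in X (s n) p) (arc_in X x p)) \<longlonglongrightarrow> 0"
    using X(2) s by (simp add: smooth_at_def)
  then have "\<forall>\<^sub>F n in sequentially. hausdorff_dist (arc_in X (s n) p) (arc_in X x p) < r"
    using r(1) by (rule order_tendstoD)
  then show ?thesis
  proof (rule eventually_mono)
    fix n assume n: "hausdorff_dist (arc_in X (s n) p) (arc_in X x p) < r"
    show "arc_in X (s n) p \<subseteq> V"
    proof
      fix y assume "y \<in> arc_in X (s n) p"
      then have "infdist y (arc_in X x p) < r"
        using infdist_le_hausdorff_dist[OF arc_in_properties(4)[OF X(1) s(1) p], of y n] n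
        by (meson le_less_trans)
      \<comment> \<open>The arc contains \<open>x\<close>, so \<open>infdist\<close> is a genuine
        infimum here and not the default 0 of the empty set.\<close>
      then obtain a where "a \<in> arc_in X x p" "dist y a < r"
        using cInf_lessD[of "dist y ` arc_in X x p" r] K(2) by (auto simp: infdist_def split: if_splits)
      then have "y \<in> (\<Union>a\<in>arc_in X x p. ball a r)" by (auto simp: dist_commute)
      then show "y \<in> V" using r(2) by blast
    qed
  qed
qed

text \<open>Otherwise arcs coming ever closer to \<open>e\<close> start at points subconverging to
  some \<open>l\<close> outside \<open>ball e \<epsilon>\<close>. The arc from \<open>l\<close>
  misses \<open>e\<close> by maximality, and the nearby arcs stay close to it.\<close>

lemma arcs_avoid_ball_around_endpoint:
  fixes X :: "'a::real_normed_vector set"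
  assumes X: "dendroid X" "smooth_at X p" and e: "e \<in> endpoints X - {p}" and "\<epsilon> > 0"
  obtains \<delta> where "\<delta> > 0" "\<And>x. x \<in> X - ball e \<epsilon> \<Longrightarrow> arc_in X x p \<inter> ball e \<delta> = {}"
proof (rule ccontr)
  assume contra: "\<not> thesis"
  have p: "p \<in> X" using X(2) by (simp add: smooth_at_def)
  have "\<exists>x y. x \<in> X - ball e \<epsilon> \<and> y \<in> arc_in X x p \<and> y \<in> ball e (inverse (Suc n))" for n
    using contra that[of "inverse (Suc n)"] by fastforce
  then obtain x y where xy: "\<And>n. x n \<in> X - ball e \<epsilon>" "\<And>n. y n \<in> arc_in X (x n) p"
      "\<And>n. y n \<in> ball e (inverse (Suc n))"
    by metis
  have "compact X" using X(1) by (simp add: dendroid_def continuum_def)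
  then have "compact (X - ball e \<epsilon>)" by (simp add: compact_diff)
  then obtain l k where l: "l \<in> X - ball e \<epsilon>" "strict_mono k" "(x \<circ> k) \<longlonglongrightarrow> l"
    using xy(1) by (auto simp: compact_def dest!: spec[of _ x])
  have "e \<notin> arc_in X l p"
    using endpoint_in_arc_in[OF X(1) _ p e, of l] l(1) \<open>\<epsilon> > 0\<close> by auto
  \<comment> \<open>A closed ball is chosen so that its complement is an open neighbourhood of the
    limit arc.\<close>
  then obtain r where r: "r > 0" "cball e r \<subseteq> - arc_in X l p"
    using arc_in_properties(4)[OF X(1) _ p, of l] l(1)
    by (metis ComplI DiffD1 compact_imp_closed open_Compl open_contains_cball)
  have "arc_in X l p \<subseteq> - cball e r" using r(2) by blast
  then have "\<forall>\<^sub>F n in sequentially. arc_in X ((x \<circ> k) n) p \<subseteq> - cball e r"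
    using smooth_at_arcs_eventually_subset[OF X _ _ l(3) open_Compl[OF closed_cball]] xy(1) l(1) by auto
  moreover have "\<forall>\<^sub>F n in sequentially. inverse (real (Suc n)) < r"
    using LIMSEQ_inverse_real_of_nat r(1) by (rule order_tendstoD)
  ultimately have "\<forall>\<^sub>F n in sequentially. False"
  proof eventually_elim
    case (elim n)
    have "inverse (real (Suc (k n))) \<le> inverse (real (Suc n))"
      using seq_suble[OF l(2), of n] by (simp add: le_imp_inverse_le)
    moreover have "dist e (y (k n)) < inverse (real (Suc (k n)))" using xy(3)[of "k n"] by simp
    ultimately have "y (k n) \<in> cball e r" using elim(2) unfolding mem_cball by linarith
    then show False using xy(2)[of "k n"] elim by auto
  qed
  then show False by simp
qed

section \<open>The complement of a smooth plane dendroid is connected\<close>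

text \<open>Both functions lift the same map through the covering \<open>exp\<close> of the
  punctured plane, and such lifts are determined by one value on a connected set.\<close>

lemma continuous_logarithm_unique:
  fixes g h :: "'a::topological_space \<Rightarrow> complex"
  assumes "connected S" "continuous_on S g" "continuous_on S h"
    and "\<And>x. x \<in> S \<Longrightarrow> exp (g x) = exp (h x)" "a \<in> S" "g a = h a" "x \<in> S"
  shows "g x = h x"
proof (rule covering_space_lift_unique[OF covering_space_exp_punctured_plane, of g a h S "\<lambda>x. exp (g x)"])
  show "continuous_on S (\<lambda>x. exp (g x))" by (intro continuous_intros assms)
qed (use assms in auto)

text \<open>Tietze extends \<open>g\<close> to \<open>G\<close> on \<open>X\<close>. The quotient
  \<open>q\<close> of \<open>f\<close> by \<open>exp G\<close> is 1 on \<open>K\<close>, hence near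
  1 around \<open>K\<close>, where \<open>Ln\<close> of \<open>q\<close> corrects
  \<open>G\<close>.\<close>

lemma continuous_logarithm_extends_to_neighbourhood:
  fixes X :: "'a::{metric_space,second_countable_topology} set" and f :: "'a \<Rightarrow> complex"
  assumes "continuous_on X f" "compact K" "K \<subseteq> X"
    and "continuous_on K g" "\<And>x. x \<in> K \<Longrightarrow> f x = exp (g x)"
  obtains V h where "open V" "K \<subseteq> V" "continuous_on (X \<inter> V) h"
    "\<And>x. x \<in> X \<inter> V \<Longrightarrow> f x = exp (h x)" "\<And>x. x \<in> K \<Longrightarrow> h x = g x"
proof -
  obtain G where G: "continuous_on X G" "\<And>x. x \<in> K \<Longrightarrow> G x = g x"
    using Tietze_unbounded[OF assms(4)] assms(2,3) closed_subset compact_imp_closed by metis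
  define q where "q x = f x * exp (- G x)" for x
  have q: "continuous_on X q" unfolding q_def by (intro continuous_intros assms G)
  obtain V where V: "open V" "V \<inter> X = q -` ball 1 1 \<inter> X"
    using continuous_on_open_invariant[THEN iffD1, OF q, rule_format, of "ball 1 1"] by auto
  have q1: "q x = 1" if "x \<in> K" for x
    using assms(5) that G(2) by (simp add: q_def exp_minus)
  \<comment> \<open>The unit disc about 1 lies in the open right half plane and so misses the branch
    cut of \<open>Ln\<close>.\<close>
  have nonpos: "q x \<notin> \<real>\<^sub>\<le>\<^sub>0" if "x \<in> X \<inter> V" for x
  proof
    assume "q x \<in> \<real>\<^sub>\<le>\<^sub>0"
    then have "Re (q x) \<le> 0" by (simp add: complex_nonpos_Reals_iff)
    moreover have "norm (1 - q x) < 1" using that V(2) by (auto simp: dist_norm)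
    ultimately show False
      using abs_Re_le_cmod[of "1 - q x"] by simp
  qed
  show thesis
  proof (rule that[of V "\<lambda>x. G x + Ln (q x)"])
    show "K \<subseteq> V" using q1 assms(3) V(2) by force
    have "continuous_on (X \<inter> V) q" "continuous_on (X \<inter> V) G"
      using q G(1) continuous_on_subset by blast+
    then show "continuous_on (X \<inter> V) (\<lambda>x. G x + Ln (q x))"
      using nonpos by (intro continuous_intros) auto
    show "f x = exp (G x + Ln (q x))" if "x \<in> X \<inter> V" for x
    proof -
      have "q x \<noteq> 0" using nonpos[OF that] by auto
      then show ?thesis by (simp add: exp_add q_def exp_minus)
    qed
  qed (use V q1 G(2) in auto)
qed

text \<open>Logarithms are lifted along the arcs to \<open>p\<close>; smoothness makes the endpoint values continuous.\<close>

lemma smooth_dendroid_Borsukian: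
  fixes X :: "'a::euclidean_space set"
  assumes X: "dendroid X" "smooth_at X p"
  shows "Borsukian X"
  unfolding Borsukian_continuous_logarithm
proof (intro allI impI, elim conjE)
  fix f :: "'a \<Rightarrow> complex"
  assume f: "continuous_on X f" "f \<in> X \<rightarrow> - {0}"
  have p: "p \<in> X" using X(2) by (simp add: smooth_at_def)
  note A = arc_in_properties[OF X(1) _ p]
  \<comment> \<open>The common value at \<open>p\<close> makes logarithms along different arcs
    comparable. It is reached by adding a constant whose exponential is 1.\<close>
  have "\<exists>g. continuous_on (arc_in X x p) g \<and> (\<forall>y\<in>arc_in X x p. f y = exp (g y)) \<and> g p = Ln (f p)"
    if x: "x \<in> X" for x
  proof -
    have "continuous_on (arc_in X x p) f" "\<And>y. y \<in> arc_in X x p \<Longrightarrow> f y \<noteq> 0"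
      using f A(1)[OF x] continuous_on_subset by blast+
    then obtain g where g: "continuous_on (arc_in X x p) g" "\<And>y. y \<in> arc_in X x p \<Longrightarrow> f y = exp (g y)"
      using continuous_logarithm_on_contractible[OF _ A(6)[OF x]] by metis
    have "f p \<noteq> 0" using f(2) p by auto
    then have "exp (Ln (f p) - g p) = 1"
      using g(2)[OF A(3)[OF x]] by (simp add: exp_diff)
    then show ?thesis
      using g by (intro exI[of _ "\<lambda>y. g y + (Ln (f p) - g p)"]) (auto simp: exp_add intro!: continuous_intros)
  qed
  then obtain g where g: "\<And>x. x \<in> X \<Longrightarrow> continuous_on (arc_in X x p) (g x)"
      "\<And>x y. x \<in> X \<Longrightarrow> y \<in> arc_in X x p \<Longrightarrow> f y = exp (g x y)" "\<And>x. x \<in> X \<Longrightarrow> g x p = Ln (f p)"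
    by metis
  have "continuous_on X (\<lambda>x. g x x)"
    unfolding continuous_on_sequentially
  proof (intro allI ballI impI, elim conjE)
    fix s x assume x: "x \<in> X" and s: "\<forall>n::nat. s n \<in> X" "s \<longlonglongrightarrow> x"
    obtain V h where V: "open V" "arc_in X x p \<subseteq> V" and h: "continuous_on (X \<inter> V) h"
        "\<And>y. y \<in> X \<inter> V \<Longrightarrow> f y = exp (h y)" "\<And>y. y \<in> arc_in X x p \<Longrightarrow> h y = g x y"
      using continuous_logarithm_extends_to_neighbourhood[OF f(1) A(4)[OF x] A(1)[OF x] g(1)[OF x] g(2)[OF x]]
      by metis
    have hp: "h p = Ln (f p)" using h(3)[OF A(3)[OF x]] g(3)[OF x] by simp
    have ev: "\<forall>\<^sub>F n in sequentially. arc_in X (s n) p \<subseteq> V"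
      using smooth_at_arcs_eventually_subset[OF X _ x s(2) V] s(1) by blast
    \<comment> \<open>Along the arc from \<open>s n\<close>, both \<open>h\<close> and
      \<open>g (s n)\<close> are logarithms of \<open>f\<close> with the same value at
      \<open>p\<close>, so they agree at \<open>s n\<close>.\<close>
    have "\<forall>\<^sub>F n in sequentially. h (s n) = g (s n) (s n)"
      using ev
    proof eventually_elim
      case (elim n)
      have sn: "s n \<in> X" using s(1) by blast
      have sub: "arc_in X (s n) p \<subseteq> X \<inter> V" using elim A(1)[OF sn] by blast
      show ?case
      proof (rule continuous_logarithm_unique[OF A(5)[OF sn] continuous_on_subset[OF h(1) sub] g(1)[OF sn], of p "s n"])
        show "exp (h y) = exp (g (s n) y)" if "y \<in> arc_in X (s n) p" for y
          using that sub h(2) g(2)[OF sn] by (metis subsetD)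
      qed (use A(2,3)[OF sn] hp g(3)[OF sn] in auto)
    qed
    moreover have "(\<lambda>n. h (s n)) \<longlonglongrightarrow> h x"
    proof (rule continuous_on_tendsto_compose[OF h(1) s(2)])
      show "x \<in> X \<inter> V" using x V(2) A(2)[OF x] by blast
      show "\<forall>\<^sub>F n in sequentially. s n \<in> X \<inter> V"
        using ev by eventually_elim (use s(1) A(2) in blast)
    qed
    ultimately have "(\<lambda>n. g (s n) (s n)) \<longlonglongrightarrow> h x"
      by (rule Lim_transform_eventually[rotated])
    then show "((\<lambda>x. g x x) \<circ> s) \<longlonglongrightarrow> g x x"
      using h(3)[OF A(2)[OF x]] by (simp add: o_def)
  qed
  moreover have "\<forall>x\<in>X. f x = exp (g x x)" using g(2) A(2) by blast
  ultimately show "\<exists>g. continuous_on X g \<and> (\<forall>x\<in>X. f x = exp (g x))" by blast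
qed

section \<open>Plane topology\<close>

text \<open>Serves to carry separation theorems of the complex plane over to two-dimensional
  Euclidean spaces.\<close>

lemma plane_homeomorphism_complex:
  assumes "DIM('a) = 2"
  obtains f :: "'a::euclidean_space \<Rightarrow> complex" and g where "homeomorphism UNIV UNIV f g"
proof -
  have "DIM('a) = DIM(complex)" using assms by simp
  then obtain f :: "'a \<Rightarrow> complex" and g where fg: "linear f" "linear g"
      "\<And>x. g (f x) = x" "\<And>y. f (g y) = y"
    using isomorphisms_UNIV_UNIV by metis
  then have "homeomorphism UNIV UNIV f g"
    by (auto intro!: homeomorphismI simp: linear_continuous_on linear_linear)
  then show thesis by (rule that)
qed

lemma homeomorphism_UNIV_Compl:
  assumes "homeomorphism UNIV UNIV f g"
  shows "homeomorphism (- S) (- f ` S) f g"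
proof (rule homeomorphism_of_subsets[OF assms])
  have "bij f" using assms unfolding homeomorphism_def by (metis UNIV_I bijI')
  then show "f ` (- S) = - f ` S" by (rule bij_image_Compl_eq)
qed auto

text \<open>Eilenberg's criterion for compact sets in the complex plane, transported by a
  homeomorphism of the whole planes, which also maps complements to complements.\<close>

lemma Borsukian_imp_connected_Compl:
  fixes X :: "'a::euclidean_space set"
  assumes "DIM('a) = 2" "compact X" "Borsukian X"
  shows "connected (- X)"
proof -
  obtain f :: "'a \<Rightarrow> complex" and g where fg: "homeomorphism UNIV UNIV f g"
    using plane_homeomorphism_complex[OF assms(1)] .
  have cf: "continuous_on X f"
    using homeomorphism_cont1[OF fg] continuous_on_subset by blast
  have "homeomorphism X (f ` X) f g"
    using homeomorphism_of_subsets[OF fg] by auto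
  then have "Borsukian (f ` X)"
    using assms(3) homeomorphic_Borsukian_eq homeomorphic_def by blast
  then have "connected (- f ` X)"
    using Borsukian_separation_compact compact_continuous_image[OF cf assms(2)] by blast
  then show ?thesis
    using homeomorphism_UNIV_Compl[OF fg, of X] homeomorphic_connectedness homeomorphic_def by blast
qed

lemma Janiszewski_plane:
  fixes a b :: "'a::euclidean_space"
  assumes "DIM('a) = 2" "compact S" "closed T" "connected (S \<inter> T)"
    and "connected_component (- S) a b" "connected_component (- T) a b"
  shows "connected_component (- (S \<union> T)) a b"
proof -
  obtain f :: "'a \<Rightarrow> complex" and g where fg: "homeomorphism UNIV UNIV f g"
    using plane_homeomorphism_complex[OF assms(1)] .
  have cf: "continuous_on U f" for U
    using homeomorphism_cont1[OF fg] continuous_on_subset by blast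
  have "inj f" using fg unfolding homeomorphism_def by (metis UNIV_I injI)
  have comp: "connected_component (- f ` U) (f a) (f b)" if "connected_component (- U) a b" for U
    using connected_component_homeomorphismI[OF homeomorphism_UNIV_Compl[OF fg] that] .
  have "connected_component (- (f ` S \<union> f ` T)) (f a) (f b)"
  proof (rule Janiszewski)
    show "compact (f ` S)" by (rule compact_continuous_image[OF cf assms(2)])
    show "closed (f ` T)"
      using homeomorphism_imp_closed_map[OF fg, of T] assms(3) by simp
    show "connected (f ` S \<inter> f ` T)"
      using connected_continuous_image[OF cf assms(4)] image_Int[OF \<open>inj f\<close>] by metis
  qed (use comp assms(5,6) in auto)
  then have "connected_component (- f ` (S \<union> T)) (f a) (f b)" by (simp add: image_Un)
  then show ?thesis
    using connected_component_homeomorphismI[OF homeomorphism_symD[OF homeomorphism_UNIV_Compl[OF fg]]]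
      homeomorphism_apply1[OF fg] by fastforce
qed

text \<open>
  The arcs from \<open>p\<close> to the points of \<open>X\<close> outside \<open>ball e \<epsilon>\<close> form a connected set \<open>Y\<close> avoiding
  \<open>ball e \<delta>\<close>, and \<open>X\<close> meets \<open>- ball e \<epsilon> \<union> closure Y\<close> exactly in \<open>closure Y\<close>.
\<close>

lemma complement_uniformly_connected_near_endpoint:
  fixes X :: "'a::euclidean_space set"
  assumes "DIM('a) = 2"
    and X: "dendroid X" "smooth_at X p" and e: "e \<in> endpoints X - {p}" and "\<epsilon> > 0"
  obtains \<delta> where "\<delta> > 0"
    "\<And>a b. a \<in> ball e \<delta> - X \<Longrightarrow> b \<in> ball e \<delta> - X \<Longrightarrow> path_component (ball e \<epsilon> - X) a b"
proof -
  have p: "p \<in> X" using X(2) by (simp add: smooth_at_def)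
  have cX: "compact X" using X(1) by (simp add: dendroid_def continuum_def)
  note A = arc_in_properties[OF X(1) _ p]
  obtain d where d: "d > 0" "\<And>x. x \<in> X - ball e \<epsilon> \<Longrightarrow> arc_in X x p \<inter> ball e d = {}"
    using arcs_avoid_ball_around_endpoint[OF X e \<open>\<epsilon> > 0\<close>] by metis
  \<comment> \<open>The minimum puts \<open>ball e \<delta>\<close> inside
    \<open>ball e \<epsilon>\<close>, so that it misses both parts of \<open>T\<close>.\<close>
  define \<delta> where "\<delta> = min d \<epsilon>"
  define Y where "Y = (\<Union>x\<in>X - ball e \<epsilon>. arc_in X x p)"
  \<comment> \<open>Avoiding \<open>T\<close> confines a connection to
    \<open>ball e \<epsilon>\<close>. Adding \<open>closure Y\<close> makes the intersection with
    \<open>X\<close> connected, as Janiszewski's theorem demands;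
    \<open>X - ball e \<epsilon>\<close> alone need not be.\<close>
  define T where "T = - ball e \<epsilon> \<union> closure Y"
  have "Y \<subseteq> X" using A(1) by (auto simp: Y_def)
  then have YX: "closure Y \<subseteq> X" by (simp add: closure_minimal cX compact_imp_closed)
  have "Y \<inter> ball e \<delta> = {}" using d(2) by (fastforce simp: Y_def \<delta>_def)
  then have Yd: "closure Y \<inter> ball e \<delta> = {}"
    using open_Int_closure_eq_empty[of "ball e \<delta>" Y] by (simp add: Int_commute)
  \<comment> \<open>All these arcs are connected and share the point \<open>p\<close>.\<close>
  have "connected Y"
    unfolding Y_def by (rule connected_Union[of "(\<lambda>x. arc_in X x p) ` _", simplified])
      (use A(3,5) in auto)
  moreover have "X \<inter> T = closure Y"
  proof -
    have "X - ball e \<epsilon> \<subseteq> Y" using A(2) by (auto simp: Y_def)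
    then show ?thesis using YX closure_subset[of Y] by (auto simp: T_def)
  qed
  ultimately have conn: "connected (X \<inter> T)" by (simp add: connected_imp_connected_closure)
  have T: "closed T" unfolding T_def by (intro closed_Un closed_closure closed_Compl open_ball)
  have "path_component (ball e \<epsilon> - X) a b" if ab: "a \<in> ball e \<delta> - X" "b \<in> ball e \<delta> - X" for a b
  proof -
    \<comment> \<open>Off \<open>X\<close> the points are joined because \<open>X\<close> does not
      separate the plane; off \<open>T\<close> they are joined by \<open>ball e \<delta>\<close>
      itself.\<close>
    have "connected_component (- X) a b"
      using Borsukian_imp_connected_Compl[OF assms(1) cX smooth_dendroid_Borsukian[OF X]] ab
      by (simp add: connected_iff_connected_component)
    moreover have "connected_component (- T) a b"
      unfolding connected_component_def
    proof (intro exI[of _ "ball e \<delta>"] conjI)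
      show "ball e \<delta> \<subseteq> - T" using Yd by (auto simp: T_def \<delta>_def)
    qed (use ab in auto)
    ultimately have "connected_component (- (X \<union> T)) a b"
      by (intro Janiszewski_plane[OF assms(1) cX T conn])
    then have "connected_component (ball e \<epsilon> - X) a b"
      by (rule connected_component_of_subset) (auto simp: T_def)
    then show ?thesis
      by (simp add: open_path_connected_component open_Diff cX compact_imp_closed)
  qed
  then show thesis using that[of \<delta>] d(1) \<open>\<epsilon> > 0\<close> by (simp add: \<delta>_def)
qed

section \<open>Accessibility\<close>

text \<open>Run through \<open>g n\<close> during \<open>[n, n+1]\<close>, compress the half-line to
  \<open>[0, 1)\<close> and put the value \<open>e\<close> at 1. Continuity at 1 holds because the
  images shrink to \<open>e\<close>.\<close>

lemma infinite_path_concatenation: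
  fixes g :: "nat \<Rightarrow> real \<Rightarrow> 'a::real_normed_vector"
  assumes g: "\<And>n. path (g n)" "\<And>n. pathfinish (g n) = pathstart (g (Suc n))"
    and r: "r \<longlonglongrightarrow> 0" "\<And>n. path_image (g n) \<subseteq> ball e (r n)"
  obtains h where "path h" "pathstart h = pathstart (g 0)" "pathfinish h = e"
    "path_image h \<subseteq> insert e (\<Union>n. path_image (g n))"
proof -
  define k where "k t = g (nat \<lfloor>t\<rfloor>) (t - of_int \<lfloor>t\<rfloor>)" for t :: real
  \<comment> \<open>At the right end \<open>t = n + 1\<close> the floor already selects
    \<open>g (Suc n)\<close>, whose start is the end of \<open>g n\<close>. Hence the formula holds
    on the closed interval.\<close>
  have k: "k t = g n (t - n)" if "t \<in> {real n..real n + 1}" for t n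
  proof (cases "t = real n + 1")
    case True
    then have "\<lfloor>t\<rfloor> = int (Suc n)" by (intro floor_unique) auto
    then have "k t = g (Suc n) (t - real (Suc n))" unfolding k_def by (metis nat_int of_int_of_nat_eq)
    then show ?thesis using True g(2)[of n] by (simp add: pathfinish_def pathstart_def)
  next
    case False
    then have "\<lfloor>t\<rfloor> = int n" using that by (intro floor_unique) auto
    then show ?thesis by (simp add: k_def)
  qed
  have k_in: "k t \<in> path_image (g (nat \<lfloor>t\<rfloor>))" if "t \<ge> 0" for t
    unfolding k_def path_image_def by (intro imageI) (simp, linarith)
  have piece: "continuous_on {real n..real n + 1} k" for n
  proof -
    have "continuous_on {real n..real n + 1} (\<lambda>t. g n (t - n))"
      by (rule continuous_on_compose2[OF g(1)[of n, unfolded path_def]])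
        (auto intro!: continuous_intros)
    then show ?thesis
      by (rule continuous_on_eq) (simp add: k)
  qed
  have upto: "continuous_on {0..real n} k" for n
  proof (induction n)
    case (Suc n)
    have "{0..real (Suc n)} = {0..real n} \<union> {real n..real n + 1}" by auto
    then show ?case using continuous_on_closed_Un[OF _ _ Suc piece[of n]] by simp
  qed simp
  have contk: "continuous_on {0..} k"
    unfolding continuous_on_eq_continuous_within
  proof
    fix t :: real assume t: "t \<in> {0..}"
    obtain n where n: "t < real n" using reals_Archimedean2 by blast
    have "continuous (at t within {0..real n}) k"
      using upto[of n] t n by (auto simp: continuous_on_eq_continuous_within)
    moreover have "at t within {0..real n} = at t within {0..}"
      using n by (intro at_within_nhd[of t "{..<real n}"]) auto
    ultimately show "continuous (at t within {0..}) k" by simp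
  qed
  define h where "h t = (if t < 1 then k (t / (1 - t)) else e)" for t
  have conth: "continuous (at t within {0..1}) h" if t: "t \<in> {0..1}" for t
  proof (cases "t < 1")
    case True
    have "continuous_on {0..<1} (\<lambda>t. k (t / (1 - t)))"
      by (rule continuous_on_compose2[OF contk]) (auto intro!: continuous_intros)
    then have "continuous_on {0..<1} h"
      by (rule continuous_on_eq) (simp add: h_def)
    then have "continuous (at t within {0..<1}) h"
      using True t by (auto simp: continuous_on_eq_continuous_within)
    moreover have "at t within {0..<1} = at t within {0..1}"
      using True by (intro at_within_nhd[of t "{..<1}"]) auto
    ultimately show ?thesis by simp
  next
    case False
    then have "t = 1" using t by simp
    have "\<exists>d>0. \<forall>u\<in>{0..1}. dist u 1 < d \<longrightarrow> dist (h u) (h 1) < \<epsilon>" if "\<epsilon> > 0" for \<epsilon>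
    proof -
      obtain N where N: "\<And>n. n \<ge> N \<Longrightarrow> r n < \<epsilon>"
        using order_tendstoD(2)[OF r(1) \<open>\<epsilon> > 0\<close>] unfolding eventually_sequentially by blast
      \<comment> \<open>This radius forces \<open>u / (1 - u) = 1 / (1 - u) - 1\<close> beyond
        \<open>N\<close>, where only paths inside \<open>ball e \<epsilon>\<close> remain.\<close>
      have "dist (h u) (h 1) < \<epsilon>" if u: "u \<in> {0..1}" "dist u 1 < 1 / (real N + 1)" for u
      proof (cases "u < 1")
        case True
        define t where "t = u / (1 - u)"
        have "t = 1 / (1 - u) - 1" using True by (simp add: t_def field_simps)
        moreover have "1 / (1 - u) > real N + 1"
          using u True by (simp add: dist_real_def field_simps)
        ultimately have "real N \<le> t" by simp
        then have "t \<ge> 0" "nat \<lfloor>t\<rfloor> \<ge> N" by (auto simp: le_nat_floor)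
        then have "k t \<in> ball e \<epsilon>"
          using k_in[of t] r(2)[of "nat \<lfloor>t\<rfloor>"] N[of "nat \<lfloor>t\<rfloor>"] by fastforce
        then show ?thesis using True by (simp add: h_def t_def dist_commute)
      qed (use \<open>\<epsilon> > 0\<close> u in \<open>simp add: h_def\<close>)
      then show ?thesis by (intro exI[of _ "1 / (real N + 1)"]) auto
    qed
    then show ?thesis
      unfolding \<open>t = 1\<close> continuous_within_eps_delta by blast
  qed
  show thesis
  proof (rule that[of h])
    show "path h" using conth by (simp add: path_def continuous_on_eq_continuous_within)
    show "pathstart h = pathstart (g 0)" by (simp add: pathstart_def h_def k_def)
    show "pathfinish h = e" by (simp add: pathfinish_def h_def)
    show "path_image h \<subseteq> insert e (\<Union>n. path_image (g n))"
    proof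
      fix y assume "y \<in> path_image h"
      then obtain t where t: "t \<in> {0..1}" "y = h t" by (auto simp: path_image_def)
      show "y \<in> insert e (\<Union>n. path_image (g n))"
        using t k_in[of "t / (1 - t)"] by (cases "t < 1") (auto simp: h_def)
    qed
  qed
qed

text \<open>Points of \<open>U\<close> tending to \<open>e\<close> are joined successively by paths
  in shrinking balls. The infinite concatenation of these paths ends at \<open>e\<close> and
  contains an arc.\<close>

lemma accessible_from_if_uniformly_path_connected:
  fixes e :: "'a::{complete_space,real_normed_vector}"
  assumes e: "e \<in> closure U - U"
    and U: "\<And>\<epsilon>. \<epsilon> > 0 \<Longrightarrow> \<exists>\<delta>>0. \<forall>a\<in>ball e \<delta> \<inter> U. \<forall>b\<in>ball e \<delta> \<inter> U. path_component (ball e \<epsilon> \<inter> U) a b"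
  shows "accessible_from e U"
proof -
  have "\<forall>n. \<exists>\<delta>>0. \<forall>a\<in>ball e \<delta> \<inter> U. \<forall>b\<in>ball e \<delta> \<inter> U.
      path_component (ball e (inverse (real (Suc n))) \<inter> U) a b"
    using U by (metis inverse_positive_iff_positive of_nat_0_less_iff zero_less_Suc)
  then obtain \<delta> where \<delta>: "\<And>n. \<delta> n > 0"
      "\<And>n a b. a \<in> ball e (\<delta> n) \<inter> U \<Longrightarrow> b \<in> ball e (\<delta> n) \<inter> U
        \<Longrightarrow> path_component (ball e (inverse (real (Suc n))) \<inter> U) a b"
    by metis
  \<comment> \<open>Requiring all radii up to \<open>n\<close> puts both \<open>z n\<close> and
    \<open>z (Suc n)\<close> into \<open>ball e (\<delta> n)\<close>, as joining them needs.\<close>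
  have "\<exists>z. z \<in> U \<and> (\<forall>i\<le>n. z \<in> ball e (\<delta> i))" for n
  proof -
    have "Min (\<delta> ` {..n}) > 0" using \<delta>(1) by simp
    then obtain z where "z \<in> U" "dist z e < Min (\<delta> ` {..n})"
      using e closure_approachable by blast
    then show ?thesis by (auto simp: dist_commute)
  qed
  then obtain z where z: "\<And>n. z n \<in> U" "\<And>n i. i \<le> n \<Longrightarrow> z n \<in> ball e (\<delta> i)" by metis
  have "path_component (ball e (inverse (real (Suc n))) \<inter> U) (z n) (z (Suc n))" for n
    using z by (intro \<delta>(2)) auto
  then obtain g where g: "\<And>n. path (g n)" "\<And>n. path_image (g n) \<subseteq> ball e (inverse (real (Suc n))) \<inter> U"
      "\<And>n. pathstart (g n) = z n" "\<And>n. pathfinish (g n) = z (Suc n)"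
    unfolding path_component_def by metis
  obtain h where h: "path h" "pathstart h = z 0" "pathfinish h = e"
      "path_image h \<subseteq> insert e (\<Union>n. path_image (g n))"
    using infinite_path_concatenation[of g "\<lambda>n. inverse (real (Suc n))" e] g LIMSEQ_inverse_real_of_nat
    by (metis (no_types, lifting) Int_subset_iff)
  have hU: "path_image h \<subseteq> insert e U" using h(4) g(2) by blast
  \<comment> \<open>The path \<open>h\<close> may cross itself; since its two ends differ, an arc
    ending at \<open>e\<close> can be extracted from it.\<close>
  have "z 0 \<noteq> e" using z(1)[of 0] e by auto
  then obtain \<gamma> where \<gamma>: "arc \<gamma>" "path_image \<gamma> \<subseteq> path_image h" "pathfinish \<gamma> = e"
    using path_contains_arc[OF h(1-3)] by metis
  moreover have "e \<in> path_image \<gamma>" using \<gamma>(3) by auto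
  ultimately have "path_image \<gamma> - U = {e}" using hU e by blast
  then show ?thesis using \<gamma>(1) by (auto simp: accessible_from_def)
qed

text \<open>Otherwise \<open>e\<close> would be the midpoint of a nondegenerate segment in
  \<open>X\<close>, an arc through \<open>e\<close> with other extremities.\<close>

lemma endpoint_notin_interior:
  fixes X :: "'a::euclidean_space set"
  assumes "e \<in> endpoints X"
  shows "e \<notin> interior X"
proof
  assume "e \<in> interior X"
  then obtain r where r: "r > 0" "cball e r \<subseteq> X" by (auto simp: mem_interior_cball)
  obtain b :: 'a where b: "b \<in> Basis" using nonempty_Basis by blast
  define u where "u = r *\<^sub>R b"
  have u: "norm u = r" "u \<noteq> 0" using b r(1) by (auto simp: u_def)
  have "e - u \<noteq> e + u"
  proof
    assume "e - u = e + u"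
    then have "2 *\<^sub>R u = 0" by (simp add: scaleR_2 algebra_simps)
    then show False using u by simp
  qed
  then have "is_arc_between (closed_segment (e - u) (e + u)) (e - u) (e + u)"
    unfolding is_arc_between_def by (intro exI[of _ "linepath (e - u) (e + u)"]) simp
  moreover have "closed_segment (e - u) (e + u) \<subseteq> X"
  proof -
    have "closed_segment (e - u) (e + u) \<subseteq> cball e r"
      using u by (intro closed_segment_subset) (auto simp: dist_norm)
    then show ?thesis using r(2) by blast
  qed
  moreover have "e \<in> closed_segment (e - u) (e + u)"
  proof -
    have "e = midpoint (e - u) (e + u)" by (simp add: midpoint_def scaleR_2[symmetric])
    then show ?thesis by (metis midpoint_in_closed_segment)
  qed
  ultimately have "e = e - u \<or> e = e + u"
    using assms unfolding endpoints_def by blast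
  then show False using u by auto
qed

theorem corollary7:
  fixes X :: "(real^2) set" and p e :: "real^2"
  assumes "dendroid X"
    and "smooth_at X p"
    and "e \<in> endpoints X - {p}"
  shows "accessible_from e (- X)"
proof (rule accessible_from_if_uniformly_path_connected)
  have "e \<in> X" using assms(3) by (simp add: endpoints_def)
  \<comment> \<open>As the closure of \<open>- X\<close> is the complement of the interior of
    \<open>X\<close>, this lets \<open>e\<close> be approached from outside
    \<open>X\<close>.\<close>
  moreover have "e \<notin> interior X" using endpoint_notin_interior assms(3) by blast
  ultimately show "e \<in> closure (- X) - (- X)" by (simp add: closure_complement)
next
  fix \<epsilon> :: real assume "\<epsilon> > 0"
  obtain \<delta> where "\<delta> > 0"
      "\<And>a b. a \<in> ball e \<delta> - X \<Longrightarrow> b \<in> ball e \<delta> - X \<Longrightarrow> path_component (ball e \<epsilon> - X) a b"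
    using complement_uniformly_connected_near_endpoint[OF _ assms \<open>\<epsilon> > 0\<close>] by (auto simp: eval_nat_numeral)
  then show "\<exists>\<delta>>0. \<forall>a\<in>ball e \<delta> \<inter> - X. \<forall>b\<in>ball e \<delta> \<inter> - X. path_component (ball e \<epsilon> \<inter> - X) a b"
    by (auto simp: Diff_eq)
qed

end
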